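(* Let $\Omega=[-1,1]^2$. The kernel of the Bi-Laplacian with all natural boundary conditions, i.e. the set of all solutions $u$ of $$\Delta^2 u=0 \ \text{ in } \Omega,\qquad \Delta u=0\ \text{ and }\ \partial_\nu\Delta u=0\ \text{ on }\partial\Omega,$$ consists exactly of all harmonic functions on $\Omega$ (the functions $u$ with $\Delta u=0$ in $\Omega$, with no boundary conditions imposed). This kernel contains a countably infinite system of non-zero functions that are pairwise orthogonal in $L^2(\Omega)$, and is thus infinite-dimensional.
   Context: All functions are real-valued. $\Delta=\partial_x^2+\partial_y^2$, $\Delta^2=\partial_x^4+2\partial_x^2\partial_y^2+\partial_y^4$, and $\partial_\nu$ denotes the derivative in the direction of the exterior unit normal $\nu$ on the edges of the square (away from the corners). The PDEs hold in the interior of the square. Solutions are understood classically: $u$ is $C^4$ in the interior of $\Omega$ and $\Delta u$ extends to a $C^1$ function on the closed square, so that the boundary conditions make sense pointwise. *)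

theory Defs
  imports "HOL-Analysis.Analysis" "HOL-Library.Function_Algebras"
begin

definition square :: "(real \<times> real) set" where
  "square = {-1..1} \<times> {-1..1}"

definition dx :: "(real \<times> real \<Rightarrow> real) \<Rightarrow> (real \<times> real \<Rightarrow> real)" where
  "dx u = (\<lambda>(x, y). deriv (\<lambda>s. u (s, y)) x)"

definition dy :: "(real \<times> real \<Rightarrow> real) \<Rightarrow> (real \<times> real \<Rightarrow> real)" where
  "dy u = (\<lambda>(x, y). deriv (\<lambda>t. u (x, t)) y)"

definition laplacian :: "(real \<times> real \<Rightarrow> real) \<Rightarrow> (real \<times> real \<Rightarrow> real)" where
  "laplacian u = (\<lambda>p. dx (dx u) p + dy (dy u) p)"

definition bilaplacian :: "(real \<times> real \<Rightarrow> real) \<Rightarrow> (real \<times> real \<Rightarrow> real)" where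
  "bilaplacian u =
     (\<lambda>p. (dx ^^ 4) u p + 2 * (dx ^^ 2) ((dy ^^ 2) u) p + (dy ^^ 4) u p)"

text \<open>
  Continuous differentiability of order \<open>k\<close>. Derivatives are taken within \<open>S\<close>: for open \<open>S\<close>
  this is the usual notion, and on the closed square the derivatives at boundary points are
  the one-sided ones and are continuous up to the boundary.
\<close>
primrec C_k_on :: "nat \<Rightarrow> (real \<times> real \<Rightarrow> real) \<Rightarrow> (real \<times> real) set \<Rightarrow> bool" where
  "C_k_on 0 u S \<longleftrightarrow> continuous_on S u"
| "C_k_on (Suc k) u S \<longleftrightarrow>
     (\<exists>ux uy. C_k_on k ux S \<and> C_k_on k uy S \<and>
        (\<forall>p\<in>S. (u has_derivative (\<lambda>(h, j). h * ux p + j * uy p)) (at p within S)))"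

text \<open>
  The exterior unit normal \<open>\<nu>\<close> of the square at a point \<open>p\<close> of one of the four open edges;
  the corners have no normal.
\<close>
definition exterior_normal :: "real \<times> real \<Rightarrow> real \<times> real \<Rightarrow> bool" where
  "exterior_normal p \<nu> \<longleftrightarrow>
     (\<exists>s\<in>{-1, 1}. \<exists>t\<in>{-1<..<1}.
        (p = (s, t) \<and> \<nu> = (s, 0)) \<or> (p = (t, s) \<and> \<nu> = (0, s)))"

text \<open>
  The derivative in direction \<open>\<nu>\<close> at a boundary point. Since \<open>\<nu>\<close> points out of the square,
  only parameters \<open>t < 0\<close> stay inside, hence the left-hand derivative.
\<close>
definition has_normal_derivative ::
    "(real \<times> real \<Rightarrow> real) \<Rightarrow> real \<Rightarrow> real \<times> real \<Rightarrow> real \<times> real \<Rightarrow> bool" where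
  "has_normal_derivative w d p \<nu> \<longleftrightarrow>
     ((\<lambda>t. w (p + t *\<^sub>R \<nu>)) has_real_derivative d) (at_left 0)"

text \<open>
  Real functions on the open set \<open>interior square\<close>, represented by total functions that vanish
  elsewhere. Without this normalisation, irrelevant values outside the domain would make every
  space of functions infinite-dimensional.
\<close>
definition square_functions :: "(real \<times> real \<Rightarrow> real) set" where
  "square_functions = {u. \<forall>p. p \<notin> interior square \<longrightarrow> u p = 0}"

text \<open>Here \<open>w\<close> is the extension of the Laplacian of \<open>u\<close> to the closed square.\<close>
definition bilaplace_kernel :: "(real \<times> real \<Rightarrow> real) set" where
  "bilaplace_kernel = {u \<in> square_functions.
     C_k_on 4 u (interior square) \<and>
     (\<forall>p\<in>interior square. bilaplacian u p = 0) \<and>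
     (\<exists>w. C_k_on 1 w square \<and>
        (\<forall>p\<in>interior square. w p = laplacian u p) \<and>
        (\<forall>p\<in>frontier square. w p = 0) \<and>
        (\<forall>p \<nu>. exterior_normal p \<nu> \<longrightarrow> has_normal_derivative w 0 p \<nu>))}"

definition harmonic_functions :: "(real \<times> real \<Rightarrow> real) set" where
  "harmonic_functions = {u \<in> square_functions.
     C_k_on 2 u (interior square) \<and> (\<forall>p\<in>interior square. laplacian u p = 0)}"

definition L2_square :: "(real \<times> real \<Rightarrow> real) set" where
  "L2_square = {u. set_borel_measurable lborel square u \<and>
     set_integrable lborel square (\<lambda>p. (u p)\<^sup>2)}"

definition L2_orthogonal :: "(real \<times> real \<Rightarrow> real) \<Rightarrow> (real \<times> real \<Rightarrow> real) \<Rightarrow> bool" where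
  "L2_orthogonal u v \<longleftrightarrow> (LINT p:square|lborel. u p * v p) = 0"

text \<open>The real vector space of all real-valued functions, with pointwise operations.\<close>
definition fun_scale :: "real \<Rightarrow> ('a \<Rightarrow> real) \<Rightarrow> ('a \<Rightarrow> real)" where
  "fun_scale c f = (\<lambda>x. c * f x)"

interpretation fun_space: vector_space fun_scale
  by unfold_locales (auto simp: fun_scale_def fun_eq_iff algebra_simps)

definition infinite_dimensional :: "('a \<Rightarrow> real) set \<Rightarrow> bool" where
  "infinite_dimensional V \<longleftrightarrow>
     fun_space.subspace V \<and> \<not> (\<exists>B. finite B \<and> V \<subseteq> fun_space.span B)"

end

theory Submission
  imports Defs "HOL-Complex_Analysis.Cauchy_Integral_Formula"
begin

text \<open>
  If \<open>u\<close> lies in the kernel, the extension \<open>w\<close> of \<open>\<Delta>u\<close> is harmonic in the interior, continuous up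
  to the boundary and zero there, so it vanishes by the weak maximum principle (compare \<open>w\<close> with
  \<open>w + e (x^2 + y^2)\<close>). Conversely, a harmonic \<open>C^2\<close> function is smooth because \<open>u_x - i u_y\<close> is
  holomorphic. The functions \<open>cos (n \<pi> x) exp (- n \<pi> y)\<close> are harmonic; Fubini's theorem and the
  orthogonality of the cosines on \<open>[-1, 1]\<close> make them pairwise orthogonal, and integrating a linear
  relation on the axis \<open>y = 0\<close> against the cosines shows that they are linearly independent.
\<close>

subsection \<open>Functions of class $C^k$\<close>

text \<open>The witnesses for the partial derivatives do not mention \<open>u\<close>, so only the
  outermost layer of the recursion is affected; there a derivative within \<open>S\<close> at a
  point of \<open>S\<close> depends only on the values on \<open>S\<close>.\<close>

lemma C_k_on_cong:
  assumes "\<And>p. p \<in> S \<Longrightarrow> u p = v p"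
  shows "C_k_on k u S \<longleftrightarrow> C_k_on k v S"
proof (cases k)
  case 0
  then show ?thesis using assms by (auto cong: continuous_on_cong)
next
  case (Suc m)
  have "(u has_derivative D) (at p within S) \<longleftrightarrow> (v has_derivative D) (at p within S)"
    if "p \<in> S" for p D
    using has_derivative_transform[OF that, of u v D] has_derivative_transform[OF that, of v u D] assms
    by auto
  then show ?thesis by (simp add: Suc)
qed

lemma C_k_on_Suc_imp: "C_k_on (Suc k) u S \<Longrightarrow> C_k_on k u S"
proof (induction k arbitrary: u)
  case 0
  then show ?case
    by (auto simp: continuous_on_eq_continuous_within intro: has_derivative_continuous)
next
  case (Suc k)
  obtain ux uy where u: "C_k_on (Suc k) ux S" "C_k_on (Suc k) uy S"
    "\<forall>p\<in>S. (u has_derivative (\<lambda>(h, j). h * ux p + j * uy p)) (at p within S)"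
    using Suc.prems unfolding C_k_on.simps(2)[of "Suc k"] by blast
  show ?case
    using Suc.IH[OF u(1)] Suc.IH[OF u(2)] u(3) unfolding C_k_on.simps(2)[of k] by blast
qed

lemma C_k_on_mono: "C_k_on n u S \<Longrightarrow> m \<le> n \<Longrightarrow> C_k_on m u S"
  by (induction n) (auto simp: le_Suc_eq simp del: C_k_on.simps dest: C_k_on_Suc_imp)

lemma C_k_on_subset: "C_k_on k u S \<Longrightarrow> T \<subseteq> S \<Longrightarrow> C_k_on k u T"
proof (induction k arbitrary: u)
  case 0
  then show ?case by (auto intro: continuous_on_subset)
next
  case (Suc k)
  obtain ux uy where u: "C_k_on k ux S" "C_k_on k uy S"
    "\<And>p. p \<in> S \<Longrightarrow> (u has_derivative (\<lambda>(h, j). h * ux p + j * uy p)) (at p within S)"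
    using Suc.prems(1) by auto
  have "(u has_derivative (\<lambda>(h, j). h * ux p + j * uy p)) (at p within T)" if "p \<in> T" for p
    using has_derivative_subset[OF u(3) Suc.prems(2)] that Suc.prems(2) by blast
  then show ?case
    using Suc.IH[OF u(1) Suc.prems(2)] Suc.IH[OF u(2) Suc.prems(2)] by (simp, blast)
qed

lemma C_k_on_add: "C_k_on k u S \<Longrightarrow> C_k_on k v S \<Longrightarrow> C_k_on k (\<lambda>p. u p + v p) S"
proof (induction k arbitrary: u v)
  case 0
  then show ?case by (auto intro!: continuous_intros)
next
  case (Suc k)
  obtain ux uy where u: "C_k_on k ux S" "C_k_on k uy S"
    "\<And>p. p \<in> S \<Longrightarrow> (u has_derivative (\<lambda>(h, j). h * ux p + j * uy p)) (at p within S)"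
    using Suc.prems(1) by auto
  obtain vx vy where v: "C_k_on k vx S" "C_k_on k vy S"
    "\<And>p. p \<in> S \<Longrightarrow> (v has_derivative (\<lambda>(h, j). h * vx p + j * vy p)) (at p within S)"
    using Suc.prems(2) by auto
  have "((\<lambda>p. u p + v p) has_derivative
      (\<lambda>(h, j). h * (ux p + vx p) + j * (uy p + vy p))) (at p within S)" if "p \<in> S" for p
    by (rule has_derivative_eq_rhs[OF has_derivative_add[OF u(3)[OF that] v(3)[OF that]]])
      (auto simp: algebra_simps)
  then show ?case
    using Suc.IH[OF u(1) v(1)] Suc.IH[OF u(2) v(2)] by (simp, blast)
qed

lemma C_k_on_scale: "C_k_on k u S \<Longrightarrow> C_k_on k (\<lambda>p. c * u p) S"
proof (induction k arbitrary: u)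
  case 0
  then show ?case by (auto intro!: continuous_intros)
next
  case (Suc k)
  obtain ux uy where u: "C_k_on k ux S" "C_k_on k uy S"
    "\<And>p. p \<in> S \<Longrightarrow> (u has_derivative (\<lambda>(h, j). h * ux p + j * uy p)) (at p within S)"
    using Suc.prems by auto
  have "((\<lambda>p. c * u p) has_derivative
      (\<lambda>(h, j). h * (c * ux p) + j * (c * uy p))) (at p within S)" if "p \<in> S" for p
    by (rule has_derivative_eq_rhs[OF has_derivative_mult_right[OF u(3)[OF that]]])
      (auto simp: algebra_simps)
  then show ?case
    using Suc.IH[OF u(1)] Suc.IH[OF u(2)] by (simp, blast)
qed

text \<open>Chain rule along the two coordinate lines through \<open>(x, y)\<close>.\<close>

lemma has_derivative_imp_partials:
  assumes "(u has_derivative (\<lambda>(h, j). h * a + j * b)) (at (x, y))"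
  shows "((\<lambda>s. u (s, y)) has_real_derivative a) (at x)"
    and "((\<lambda>t. u (x, t)) has_real_derivative b) (at y)"
proof -
  have "((\<lambda>s. u (s, y)) has_derivative (\<lambda>h. h * a)) (at x)"
    by (rule has_derivative_eq_rhs[OF has_derivative_compose[where f = "\<lambda>s. (s, y)" and g = u]])
      (auto intro!: derivative_eq_intros assms[THEN has_derivative_at_withinI])
  then show "((\<lambda>s. u (s, y)) has_real_derivative a) (at x)"
    by (simp add: has_field_derivative_def mult_commute_abs)
  have "((\<lambda>t. u (x, t)) has_derivative (\<lambda>j. j * b)) (at y)"
    by (rule has_derivative_eq_rhs[OF has_derivative_compose[where f = "\<lambda>t. (x, t)" and g = u]])
      (auto intro!: derivative_eq_intros assms[THEN has_derivative_at_withinI])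
  then show "((\<lambda>t. u (x, t)) has_real_derivative b) (at y)"
    by (simp add: has_field_derivative_def mult_commute_abs)
qed

lemma dx_dy_eqI:
  assumes "(u has_derivative (\<lambda>(h, j). h * a + j * b)) (at p)"
  shows "dx u p = a" "dy u p = b"
proof -
  obtain x y where p: "p = (x, y)" by force
  note D = has_derivative_imp_partials[OF assms[unfolded p]]
  show "dx u p = a" "dy u p = b"
    using D[THEN DERIV_imp_deriv] by (simp_all add: dx_def dy_def p)
qed

lemma C_k_on_Suc_open_iff:
  assumes "open S"
  shows "C_k_on (Suc k) u S \<longleftrightarrow>
    (\<exists>ux uy. C_k_on k ux S \<and> C_k_on k uy S \<and>
      (\<forall>p\<in>S. (u has_derivative (\<lambda>(h, j). h * ux p + j * uy p)) (at p)))"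
  unfolding C_k_on.simps
  by (intro arg_cong[of _ _ Ex] ext conj_cong ball_cong refl) (simp only: at_within_open[OF _ assms])

text \<open>On an open set the total derivative determines its coefficients, so the existential
  witnesses of \<open>C_k_on\<close> coincide on \<open>S\<close> with \<open>dx u\<close> and
  \<open>dy u\<close>. This links the recursive notion to the concrete partial derivatives.\<close>

lemma
  assumes "open S" "C_k_on (Suc k) u S"
  shows C_k_on_dx: "C_k_on k (dx u) S" and C_k_on_dy: "C_k_on k (dy u) S"
    and C_k_on_has_derivative:
      "\<And>p. p \<in> S \<Longrightarrow> (u has_derivative (\<lambda>(h, j). h * dx u p + j * dy u p)) (at p)"
proof -
  obtain ux uy where u: "C_k_on k ux S" "C_k_on k uy S"
    "\<forall>p\<in>S. (u has_derivative (\<lambda>(h, j). h * ux p + j * uy p)) (at p)"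
    using assms(2) unfolding C_k_on_Suc_open_iff[OF assms(1)] by blast
  have eq: "dx u p = ux p" "dy u p = uy p" if "p \<in> S" for p
    using dx_dy_eqI[OF u(3)[rule_format, OF that]] .
  show "C_k_on k (dx u) S"
    by (rule iffD2[OF C_k_on_cong[OF eq(1)] u(1)])
  show "C_k_on k (dy u) S"
    by (rule iffD2[OF C_k_on_cong[OF eq(2)] u(2)])
  show "(u has_derivative (\<lambda>(h, j). h * dx u p + j * dy u p)) (at p)" if "p \<in> S" for p
    using u(3)[rule_format, OF that] by (simp only: eq[OF that])
qed

lemma C_k_on_SucI:
  assumes "open S" "C_k_on k ux S" "C_k_on k uy S"
    "\<And>p. p \<in> S \<Longrightarrow> (u has_derivative (\<lambda>(h, j). h * ux p + j * uy p)) (at p)"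
  shows "C_k_on (Suc k) u S"
  using assms unfolding C_k_on_Suc_open_iff[OF assms(1)] by blast

lemma C_k_on_partials:
  assumes "open S" "C_k_on (Suc k) u S" "(x, y) \<in> S"
  shows "((\<lambda>s. u (s, y)) has_real_derivative dx u (x, y)) (at x)"
    and "((\<lambda>t. u (x, t)) has_real_derivative dy u (x, y)) (at y)"
  by (rule has_derivative_imp_partials[OF C_k_on_has_derivative[OF assms]])+

text \<open>A partial derivative at \<open>p\<close> only sees values on a short segment through
  \<open>p\<close>, and an open box around \<open>p\<close> inside \<open>S\<close> contains such a
  segment in either direction.\<close>

lemma dx_dy_cong:
  assumes "open S" "p \<in> S" "\<And>q. q \<in> S \<Longrightarrow> u q = v q"
  shows "dx u p = dx v p" "dy u p = dy v p"
proof -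
  obtain x y where p: "p = (x, y)" by force
  obtain A B where "open A" "open B" "p \<in> A \<times> B" "A \<times> B \<subseteq> S"
    by (rule open_prod_elim[OF assms(1,2)])
  then have AB: "open A" "open B" "x \<in> A" "y \<in> B" "A \<times> B \<subseteq> S"
    by (simp_all add: p)
  have "eventually (\<lambda>s. u (s, y) = v (s, y)) (nhds x)"
    by (rule eventually_mono[OF eventually_nhds_in_open[OF AB(1,3)]]) (use AB assms in auto)
  then show "dx u p = dx v p" by (simp add: dx_def p deriv_cong_ev)
  have "eventually (\<lambda>t. u (x, t) = v (x, t)) (nhds y)"
    by (rule eventually_mono[OF eventually_nhds_in_open[OF AB(2,4)]]) (use AB assms in auto)
  then show "dy u p = dy v p" by (simp add: dy_def p deriv_cong_ev)
qed

lemma laplacian_cong: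
  assumes "open S" "p \<in> S" "\<And>q. q \<in> S \<Longrightarrow> u q = v q"
  shows "laplacian u p = laplacian v p"
proof -
  have "dx (dx u) p = dx (dx v) p"
    by (rule dx_dy_cong(1)[OF assms(1,2)]) (rule dx_dy_cong(1)[OF assms(1) _ assms(3)])
  moreover have "dy (dy u) p = dy (dy v) p"
    by (rule dx_dy_cong(2)[OF assms(1,2)]) (rule dx_dy_cong(2)[OF assms(1) _ assms(3)])
  ultimately show ?thesis by (simp add: laplacian_def)
qed

lemma dx_dy_add:
  assumes "open S" "C_k_on (Suc k) u S" "C_k_on (Suc l) v S" "p \<in> S"
  shows "dx (\<lambda>q. u q + v q) p = dx u p + dx v p" "dy (\<lambda>q. u q + v q) p = dy u p + dy v p"
proof -
  have "((\<lambda>q. u q + v q) has_derivative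
      (\<lambda>(h, j). h * (dx u p + dx v p) + j * (dy u p + dy v p))) (at p)"
    by (rule has_derivative_eq_rhs[OF has_derivative_add[OF
        C_k_on_has_derivative[OF assms(1,2,4)] C_k_on_has_derivative[OF assms(1,3,4)]]])
      (auto simp: algebra_simps)
  from dx_dy_eqI[OF this] show "dx (\<lambda>q. u q + v q) p = dx u p + dx v p"
    "dy (\<lambda>q. u q + v q) p = dy u p + dy v p" .
qed

lemma dx_dy_scale:
  assumes "open S" "C_k_on (Suc k) u S" "p \<in> S"
  shows "dx (\<lambda>q. c * u q) p = c * dx u p" "dy (\<lambda>q. c * u q) p = c * dy u p"
proof -
  have "((\<lambda>q. c * u q) has_derivative (\<lambda>(h, j). h * (c * dx u p) + j * (c * dy u p))) (at p)"
    by (rule has_derivative_eq_rhs[OF has_derivative_mult_right[OF C_k_on_has_derivative[OF assms]]])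
      (auto simp: algebra_simps)
  from dx_dy_eqI[OF this] show "dx (\<lambda>q. c * u q) p = c * dx u p"
    "dy (\<lambda>q. c * u q) p = c * dy u p" .
qed

lemma laplacian_add:
  assumes S: "open S" and u: "C_k_on 2 u S" and v: "C_k_on 2 v S" and p: "p \<in> S"
  shows "laplacian (\<lambda>q. u q + v q) p = laplacian u p + laplacian v p"
proof -
  have u': "C_k_on (Suc 1) u S" and v': "C_k_on (Suc 1) v S"
    using u v by (simp_all add: numeral_2_eq_2)
  have "dx (dx (\<lambda>q. u q + v q)) p = dx (\<lambda>q. dx u q + dx v q) p"
    by (rule dx_dy_cong(1)[OF S p]) (rule dx_dy_add(1)[OF S u' v'])
  moreover have "dy (dy (\<lambda>q. u q + v q)) p = dy (\<lambda>q. dy u q + dy v q) p"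
    by (rule dx_dy_cong(2)[OF S p]) (rule dx_dy_add(2)[OF S u' v'])
  moreover have "dx (\<lambda>q. dx u q + dx v q) p = dx (dx u) p + dx (dx v) p"
    by (rule dx_dy_add(1)[OF S _ _ p, of 0 _ 0]) (use C_k_on_dx[OF S u'] C_k_on_dx[OF S v'] in simp_all)
  moreover have "dy (\<lambda>q. dy u q + dy v q) p = dy (dy u) p + dy (dy v) p"
    by (rule dx_dy_add(2)[OF S _ _ p, of 0 _ 0]) (use C_k_on_dy[OF S u'] C_k_on_dy[OF S v'] in simp_all)
  ultimately show ?thesis by (simp add: laplacian_def)
qed

lemma laplacian_scale:
  assumes S: "open S" and u: "C_k_on 2 u S" and p: "p \<in> S"
  shows "laplacian (\<lambda>q. c * u q) p = c * laplacian u p"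
proof -
  have u': "C_k_on (Suc 1) u S"
    using u by (simp_all add: numeral_2_eq_2)
  have "dx (dx (\<lambda>q. c * u q)) p = dx (\<lambda>q. c * dx u q) p"
    by (rule dx_dy_cong(1)[OF S p]) (rule dx_dy_scale(1)[OF S u'])
  moreover have "dy (dy (\<lambda>q. c * u q)) p = dy (\<lambda>q. c * dy u q) p"
    by (rule dx_dy_cong(2)[OF S p]) (rule dx_dy_scale(2)[OF S u'])
  moreover have "dx (\<lambda>q. c * dx u q) p = c * dx (dx u) p"
    by (rule dx_dy_scale(1)[OF S _ p, of 0]) (use C_k_on_dx[OF S u'] in simp_all)
  moreover have "dy (\<lambda>q. c * dy u q) p = c * dy (dy u) p"
    by (rule dx_dy_scale(2)[OF S _ p, of 0]) (use C_k_on_dy[OF S u'] in simp_all)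
  ultimately show ?thesis by (simp add: laplacian_def algebra_simps)
qed

subsection \<open>Symmetry of mixed partial derivatives\<close>

text \<open>The mean value theorem is applied twice: first in \<open>s\<close> to the difference of
  \<open>u\<close> between heights \<open>y + h\<close> and \<open>y\<close>, then in
  \<open>t\<close> to the resulting difference of \<open>a\<close>.\<close>

lemma second_difference_eq:
  fixes u a c :: "real \<times> real \<Rightarrow> real"
  assumes "h > 0"
    and a: "\<And>s t. s \<in> {x..x+h} \<Longrightarrow> t \<in> {y..y+h} \<Longrightarrow> ((\<lambda>s. u (s, t)) has_real_derivative a (s, t)) (at s)"
    and c: "\<And>s t. s \<in> {x..x+h} \<Longrightarrow> t \<in> {y..y+h} \<Longrightarrow> ((\<lambda>t. a (s, t)) has_real_derivative c (s, t)) (at t)"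
  shows "\<exists>\<xi>\<in>{x..x+h}. \<exists>\<eta>\<in>{y..y+h}.
    u (x + h, y + h) - u (x + h, y) - u (x, y + h) + u (x, y) = h * h * c (\<xi>, \<eta>)"
proof -
  define f where "f s = u (s, y + h) - u (s, y)" for s
  have "(f has_real_derivative a (s, y + h) - a (s, y)) (at s)" if "x \<le> s" "s \<le> x + h" for s
    unfolding f_def using that \<open>h > 0\<close> by (intro DERIV_diff a) auto
  then obtain \<xi> where \<xi>: "x < \<xi>" "\<xi> < x + h" "f (x + h) - f x = h * (a (\<xi>, y + h) - a (\<xi>, y))"
    using MVT2[of x "x + h" f "\<lambda>s. a (s, y + h) - a (s, y)"] \<open>h > 0\<close> by auto
  obtain \<eta> where \<eta>: "y < \<eta>" "\<eta> < y + h" "a (\<xi>, y + h) - a (\<xi>, y) = h * c (\<xi>, \<eta>)"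
    using MVT2[of y "y + h" "\<lambda>t. a (\<xi>, t)" "\<lambda>t. c (\<xi>, t)"] \<open>h > 0\<close> c \<xi> by auto
  show ?thesis
    by (rule bexI[of _ \<xi>], rule bexI[of _ \<eta>]) (use \<xi> \<eta> in \<open>auto simp: f_def\<close>)
qed

text \<open>Schwarz's theorem. The second difference of \<open>u\<close> over a small square is
  symmetric in the two coordinates, so it equals \<open>h * h\<close> times a value of either mixed
  partial near \<open>p\<close>; continuity of both at \<open>p\<close> forces equality
  there.\<close>

lemma mixed_partials_commute:
  assumes S: "open S" and u: "C_k_on (Suc (Suc k)) u S" and p: "p \<in> S"
  shows "dx (dy u) p = dy (dx u) p"
proof -
  obtain x y where xy: "p = (x, y)" by force
  note ux = C_k_on_dx[OF S u] and uy = C_k_on_dy[OF S u]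
  have cont: "isCont (dx (dy u)) p" "isCont (dy (dx u)) p"
    using C_k_on_dx[OF S uy] C_k_on_dy[OF S ux] S p C_k_on_mono[of k _ S 0]
    by (auto simp: continuous_on_eq_continuous_at)
  have "\<bar>dx (dy u) p - dy (dx u) p\<bar> \<le> e" if "e > 0" for e
  proof -
    obtain d1 where d1: "d1 > 0" "\<And>q. dist q p < d1 \<Longrightarrow> \<bar>dx (dy u) q - dx (dy u) p\<bar> < e / 2"
      using cont(1) \<open>e > 0\<close> unfolding continuous_at_eps_delta dist_real_def
      by (metis half_gt_zero)
    obtain d2 where d2: "d2 > 0" "\<And>q. dist q p < d2 \<Longrightarrow> \<bar>dy (dx u) q - dy (dx u) p\<bar> < e / 2"
      using cont(2) \<open>e > 0\<close> unfolding continuous_at_eps_delta dist_real_def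
      by (metis half_gt_zero)
    obtain d3 where d3: "d3 > 0" "ball p d3 \<subseteq> S"
      using S p openE by blast
    define d where "d = min d1 (min d2 d3)"
    \<comment> \<open>Points of the box differ from \<open>p\<close> by at most \<open>h\<close> in
      each coordinate, so their distance is at most \<open>2 * h < d\<close>.\<close>
    define h where "h = d / 3"
    have h: "h > 0" "d = 3 * h" using d1 d2 d3 by (auto simp: h_def d_def)
    have near: "dist (s, t) p < d" if "s \<in> {x..x+h}" "t \<in> {y..y+h}" for s t
    proof -
      have "dist (s, t) p \<le> \<bar>s - x\<bar> + \<bar>t - y\<bar>"
        unfolding xy dist_Pair_Pair dist_real_def by (rule sqrt_sum_squares_le_sum) simp_all
      then show ?thesis using that h by auto
    qed
    have inS: "(s, t) \<in> S" if "s \<in> {x..x+h}" "t \<in> {y..y+h}" for s t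
      using near[OF that] d3 by (auto simp: d_def dist_commute subset_iff)
    have "\<exists>\<xi>\<in>{x..x+h}. \<exists>\<eta>\<in>{y..y+h}.
        u (x + h, y + h) - u (x + h, y) - u (x, y + h) + u (x, y) = h * h * dy (dx u) (\<xi>, \<eta>)"
      by (rule second_difference_eq[OF h(1), where a = "dx u"])
        (use C_k_on_partials[OF S u] C_k_on_partials[OF S ux] inS in auto)
    then obtain \<xi> \<eta> where 1: "\<xi> \<in> {x..x+h}" "\<eta> \<in> {y..y+h}"
        "u (x + h, y + h) - u (x + h, y) - u (x, y + h) + u (x, y) = h * h * dy (dx u) (\<xi>, \<eta>)"
      by blast
    \<comment> \<open>The same second difference, with the roles of the coordinates exchanged by
      passing to the transposed function.\<close>
    have "\<exists>\<eta>\<in>{y..y+h}. \<exists>\<xi>\<in>{x..x+h}.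
        u (x + h, y + h) - u (x, y + h) - u (x + h, y) + u (x, y) = h * h * dx (dy u) (\<xi>, \<eta>)"
      using second_difference_eq[OF h(1), of y x "\<lambda>(t, s). u (s, t)" "\<lambda>(t, s). dy u (s, t)"
          "\<lambda>(t, s). dx (dy u) (s, t)"] C_k_on_partials[OF S u] C_k_on_partials[OF S uy] inS
      by auto
    then obtain \<xi>' \<eta>' where 2: "\<xi>' \<in> {x..x+h}" "\<eta>' \<in> {y..y+h}"
        "u (x + h, y + h) - u (x, y + h) - u (x + h, y) + u (x, y) = h * h * dx (dy u) (\<xi>', \<eta>')"
      by blast
    have "h * h * dy (dx u) (\<xi>, \<eta>) = h * h * dx (dy u) (\<xi>', \<eta>')"
      using 1 2 by linarith
    then have "dy (dx u) (\<xi>, \<eta>) = dx (dy u) (\<xi>', \<eta>')" using h by simp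
    moreover have "\<bar>dy (dx u) (\<xi>, \<eta>) - dy (dx u) p\<bar> < e / 2"
      by (rule d2) (use near[OF 1(1,2)] in \<open>simp add: d_def\<close>)
    moreover have "\<bar>dx (dy u) (\<xi>', \<eta>') - dx (dy u) p\<bar> < e / 2"
      by (rule d1) (use near[OF 2(1,2)] in \<open>simp add: d_def\<close>)
    ultimately show ?thesis by linarith
  qed
  then have "\<bar>dx (dy u) p - dy (dx u) p\<bar> \<le> 0"
    by (metis dense_ge)
  then show ?thesis by simp
qed

text \<open>Expanding the iterated Laplacian gives the two pure fourth derivatives and two mixed
  ones; Schwarz's theorem merges the latter into the term with factor 2.\<close>

lemma bilaplacian_eq_laplacian_laplacian:
  assumes S: "open S" and u: "C_k_on 4 u S" and p: "p \<in> S"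
  shows "bilaplacian u p = laplacian (laplacian u) p"
proof -
  have u4: "C_k_on (Suc (Suc (Suc (Suc 0)))) u S" using u by (simp add: eval_nat_numeral)
  note x = C_k_on_dx[OF S] and y = C_k_on_dy[OF S]
  \<comment> \<open>Moving one \<open>dy\<close> past two \<open>dx\<close> takes two applications
    of Schwarz's theorem, to \<open>dx v\<close> and to \<open>v\<close>. Below, this is used for
    \<open>u\<close> and then for \<open>dy u\<close>.\<close>
  have comm: "dy (dx (dx v)) q = dx (dx (dy v)) q"
    if v: "C_k_on (Suc (Suc (Suc 0))) v S" and q: "q \<in> S" for v q
  proof -
    have "dy (dx (dx v)) q = dx (dy (dx v)) q"
      using mixed_partials_commute[OF S x[OF v] q] by simp
    also have "\<dots> = dx (dx (dy v)) q"
      by (rule dx_dy_cong(1)[OF S q]) (use mixed_partials_commute[OF S v] in simp)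
    finally show ?thesis .
  qed
  have *: "dy (dy (dx (dx u))) p = dx (dx (dy (dy u))) p"
  proof -
    have "dy (dy (dx (dx u))) p = dy (dx (dx (dy u))) p"
      by (rule dx_dy_cong(2)[OF S p]) (rule comm[OF C_k_on_Suc_imp[OF u4]])
    also have "\<dots> = dx (dx (dy (dy u))) p"
      by (rule comm[OF y[OF u4] p])
    finally show ?thesis .
  qed
  have "laplacian (laplacian u) p = laplacian (dx (dx u)) p + laplacian (dy (dy u)) p"
    using laplacian_add[OF S _ _ p, of "dx (dx u)" "dy (dy u)"] x[OF x[OF u4]] y[OF y[OF u4]]
    by (simp add: numeral_2_eq_2 laplacian_def)
  then show ?thesis
    using * by (simp add: bilaplacian_def laplacian_def eval_nat_numeral)
qed

subsection \<open>The weak maximum principle\<close>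

text \<open>At a local maximum \<open>f'\<close> vanishes. If \<open>l\<close> were positive,
  \<open>f'\<close> would be positive just to the right of \<open>x\<close>, and the mean value
  theorem would give values of \<open>f\<close> above the maximum.\<close>

lemma second_derivative_at_max_nonpos:
  fixes f f' :: "real \<Rightarrow> real"
  assumes max: "eventually (\<lambda>t. f t \<le> f x) (nhds x)"
    and f: "eventually (\<lambda>t. (f has_real_derivative f' t) (at t)) (nhds x)"
    and f': "(f' has_real_derivative l) (at x)"
  shows "l \<le> 0"
proof (rule ccontr)
  assume "\<not> l \<le> 0"
  then obtain d where d: "d > 0" "\<And>h. 0 < h \<Longrightarrow> h < d \<Longrightarrow> f' x < f' (x + h)"
    using DERIV_pos_inc_right[OF f'] by auto
  obtain e where e: "e > 0" "\<And>t. \<bar>t - x\<bar> < e \<Longrightarrow> f t \<le> f x"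
    "\<And>t. \<bar>t - x\<bar> < e \<Longrightarrow> (f has_real_derivative f' t) (at t)"
    using eventually_conj[OF max f] unfolding eventually_nhds_metric dist_real_def by blast
  have "f' x = 0"
    by (rule DERIV_local_max[OF e(3)[of x] e(1)]) (use e in \<open>auto simp: abs_minus_commute\<close>)
  define h where "h = min d e / 2"
  have h: "0 < h" "h < d" "h < e" using d e by (auto simp: h_def)
  have "\<exists>z. x < z \<and> z < x + h \<and> f (x + h) - f x = (x + h - x) * f' z"
    by (rule MVT2) (use h in \<open>auto intro!: e(3)\<close>)
  then obtain z where z: "x < z" "z < x + h" "f (x + h) - f x = h * f' z" by auto
  have "f' z > 0" using d(2)[of "z - x"] z h \<open>f' x = 0\<close> by auto
  then have "f (x + h) > f x" using z h by (smt (verit) mult_pos_pos)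
  then show False using e(2)[of "x + h"] h by auto
qed

text \<open>Adding \<open>e * n\<close> makes the Laplacian equal to \<open>4 * e > 0\<close> in the
  interior, which excludes an interior maximum of the perturbed function. Its maximum therefore lies
  on the frontier, where it is at most \<open>e * B\<close>; then \<open>e\<close> tends to
  0.\<close>

lemma maximum_principle_le:
  assumes K: "compact K" and cont: "continuous_on K w" and w: "C_k_on 2 w (interior K)"
    and lap: "\<And>p. p \<in> interior K \<Longrightarrow> laplacian w p = 0"
    and bdry: "\<And>p. p \<in> frontier K \<Longrightarrow> w p \<le> 0" and q: "q \<in> K"
  shows "w q \<le> 0"
proof -
  have w2: "C_k_on (Suc 1) w (interior K)" using w by (simp add: numeral_2_eq_2)
  define n :: "real \<times> real \<Rightarrow> real" where "n = (\<lambda>p. (fst p)\<^sup>2 + (snd p)\<^sup>2)"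
  have n_cont: "continuous_on K n" unfolding n_def by (intro continuous_intros)
  obtain B where B: "\<And>p. p \<in> K \<Longrightarrow> n p \<le> B"
    using continuous_attains_sup[OF K _ n_cont] q by auto
  have n0: "n p \<ge> 0" for p by (simp add: n_def)
  have *: "w q \<le> e * B" if "e > 0" for e
  proof -
    define v where "v = (\<lambda>p. w p + e * n p)"
    have "continuous_on K v" unfolding v_def by (intro continuous_intros cont n_cont)
    then obtain p where p: "p \<in> K" "\<And>r. r \<in> K \<Longrightarrow> v r \<le> v p"
      using continuous_attains_sup[OF K, of v] q by blast
    have "p \<notin> interior K"
    proof
      assume pI: "p \<in> interior K"
      obtain x y where xy: "p = (x, y)" by force
      obtain A C where "open A" "open C" "p \<in> A \<times> C" "A \<times> C \<subseteq> interior K"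
        by (rule open_prod_elim[OF open_interior pI])
      then have AC: "open A" "open C" "x \<in> A" "y \<in> C" "A \<times> C \<subseteq> interior K"
        by (simp_all add: xy)
      have K': "(s, t) \<in> interior K" "(s, t) \<in> K" if "s \<in> A" "t \<in> C" for s t
        using AC that interior_subset[of K] by auto
      \<comment> \<open>The left side is the second derivative of \<open>v\<close> along the
        horizontal line through its maximum point \<open>p\<close>; the vertical line is treated
        alike, and adding both contradicts \<open>laplacian w p = 0\<close>.\<close>
      have "dx (dx w) p + 2 * e \<le> 0"
      proof (rule second_derivative_at_max_nonpos[where f = "\<lambda>s. v (s, y)" and x = x
            and f' = "\<lambda>s. dx w (s, y) + 2 * e * s"])
        show "eventually (\<lambda>s. v (s, y) \<le> v (x, y)) (nhds x)"
          by (rule eventually_mono[OF eventually_nhds_in_open[OF AC(1,3)]])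
            (use p xy K' AC in auto)
        show "eventually (\<lambda>s. ((\<lambda>s. v (s, y)) has_real_derivative dx w (s, y) + 2 * e * s) (at s)) (nhds x)"
          by (rule eventually_mono[OF eventually_nhds_in_open[OF AC(1,3)]])
            (auto simp: v_def n_def intro!: derivative_eq_intros C_k_on_partials[OF open_interior w2] K' AC)
        show "((\<lambda>s. dx w (s, y) + 2 * e * s) has_real_derivative dx (dx w) p + 2 * e) (at x)"
          using C_k_on_partials(1)[OF open_interior, of 0 "dx w" K x y]
            C_k_on_dx[OF open_interior w2] pI
          by (auto simp: xy simp del: C_k_on.simps intro!: derivative_eq_intros)
      qed
      moreover have "dy (dy w) p + 2 * e \<le> 0"
      proof (rule second_derivative_at_max_nonpos[where f = "\<lambda>t. v (x, t)" and x = y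
            and f' = "\<lambda>t. dy w (x, t) + 2 * e * t"])
        show "eventually (\<lambda>t. v (x, t) \<le> v (x, y)) (nhds y)"
          by (rule eventually_mono[OF eventually_nhds_in_open[OF AC(2,4)]])
            (use p xy K' AC in auto)
        show "eventually (\<lambda>t. ((\<lambda>t. v (x, t)) has_real_derivative dy w (x, t) + 2 * e * t) (at t)) (nhds y)"
          by (rule eventually_mono[OF eventually_nhds_in_open[OF AC(2,4)]])
            (auto simp: v_def n_def intro!: derivative_eq_intros C_k_on_partials[OF open_interior w2] K' AC)
        show "((\<lambda>t. dy w (x, t) + 2 * e * t) has_real_derivative dy (dy w) p + 2 * e) (at y)"
          using C_k_on_partials(2)[OF open_interior, of 0 "dy w" K x y]
            C_k_on_dy[OF open_interior w2] pI
          by (auto simp: xy simp del: C_k_on.simps intro!: derivative_eq_intros)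
      qed
      ultimately show False using lap[OF pI] \<open>e > 0\<close> by (simp add: laplacian_def)
    qed
    then have "p \<in> frontier K" using p closure_subset by (auto simp: frontier_def)
    moreover have "e * n p \<le> e * B"
      using \<open>e > 0\<close> by (intro mult_left_mono B p) simp
    ultimately have "v p \<le> e * B"
      unfolding v_def using bdry[of p] by linarith
    moreover have "w q \<le> v q" using n0[of q] \<open>e > 0\<close> by (simp add: v_def)
    ultimately show ?thesis using p(2)[OF q] by linarith
  qed
  have B0: "B \<ge> 0" using B[OF q] n0[of q] by linarith
  have "w q \<le> 0 + e" if "e > 0" for e
  proof -
    \<comment> \<open>Dividing by \<open>B + 1\<close> rather than \<open>B\<close> covers the case
      \<open>B = 0\<close>.\<close>
    have "w q \<le> e / (B + 1) * B" using *[of "e / (B + 1)"] that B0 by simp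
    also have "\<dots> \<le> e" using that B0 by (simp add: field_simps)
    finally show ?thesis by simp
  qed
  then show ?thesis using field_le_epsilon by blast
qed

text \<open>The one-sided principle is applied to \<open>w\<close> and to its negative, written
  \<open>- 1 * w p\<close> so that the scaling lemmas fit.\<close>

lemma maximum_principle:
  assumes K: "compact K" and cont: "continuous_on K w" and w: "C_k_on 2 w (interior K)"
    and lap: "\<And>p. p \<in> interior K \<Longrightarrow> laplacian w p = 0"
    and bdry: "\<And>p. p \<in> frontier K \<Longrightarrow> w p = 0" and q: "q \<in> K"
  shows "w q = 0"
proof -
  have "- 1 * w q \<le> 0"
  proof (rule maximum_principle_le[OF K _ _ _ _ q])
    show "continuous_on K (\<lambda>p. - 1 * w p)" by (intro continuous_intros cont)
    show "C_k_on 2 (\<lambda>p. - 1 * w p) (interior K)" by (rule C_k_on_scale[OF w])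
    show "laplacian (\<lambda>p. - 1 * w p) p = 0" if "p \<in> interior K" for p
      using laplacian_scale[OF open_interior w that, of "-1"] lap[OF that] by simp
  qed (use bdry in auto)
  moreover have "w q \<le> 0"
    by (rule maximum_principle_le[OF K cont w lap _ q]) (use bdry in auto)
  ultimately show ?thesis by simp
qed

subsection \<open>Harmonic and holomorphic functions\<close>

text \<open>The bridge between complex analysis and real functions of two variables: for holomorphic
  \<open>g\<close> both partial derivatives are again of the form \<open>re_part\<close>, which
  allows induction on the order of differentiation.\<close>

definition re_part :: "(complex \<Rightarrow> complex) \<Rightarrow> real \<times> real \<Rightarrow> real" where
  "re_part g = (\<lambda>(x, y). Re (g (Complex x y)))"

definition complex_region :: "(real \<times> real) set \<Rightarrow> complex set" where
  "complex_region S = {z. (Re z, Im z) \<in> S}"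

lemma open_complex_region: "open S \<Longrightarrow> open (complex_region S)"
  unfolding complex_region_def using open_vimage[of S "\<lambda>z. (Re z, Im z)"]
  by (simp add: vimage_def continuous_intros)

text \<open>The complex derivative acts on the increment \<open>h + i j\<close> by multiplication,
  and the real part of \<open>g' * (h + i j)\<close> is the stated linear form.\<close>

lemma has_derivative_re_part:
  assumes "(g has_field_derivative g') (at (Complex x y))"
  shows "(re_part g has_derivative (\<lambda>(h, j). h * Re g' + j * Re (\<i> * g'))) (at (x, y))"
proof -
  have 1: "((\<lambda>p. Complex (fst p) (snd p)) has_derivative (\<lambda>p. Complex (fst p) (snd p))) (at (x, y))"
    unfolding Complex_eq by (auto intro!: derivative_eq_intros)
  have 2: "(g has_derivative (*) g') (at (Complex (fst (x, y)) (snd (x, y))))"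
    using assms by (simp add: has_field_derivative_def)
  have "((\<lambda>p. Re (g (Complex (fst p) (snd p)))) has_derivative
      (\<lambda>p. Re (g' * Complex (fst p) (snd p)))) (at (x, y))"
    by (rule has_derivative_Re[OF has_derivative_compose[OF 1 2]])
  then show ?thesis
    by (simp add: re_part_def case_prod_unfold mult.commute)
qed

text \<open>The partial derivatives are the real parts of \<open>g'\<close> and \<open>i g'\<close>,
  both holomorphic on the same open set, so the induction hypothesis for arbitrary \<open>g\<close>
  applies to them.\<close>

lemma C_k_on_re_part:
  assumes S: "open S"
  shows "g holomorphic_on complex_region S \<Longrightarrow> C_k_on k (re_part g) S"
proof (induction k arbitrary: g)
  case 0
  have "continuous_on S (\<lambda>p. Re (g (Complex (fst p) (snd p))))"
  proof (rule continuous_on_Re[OF continuous_on_compose2[OF holomorphic_on_imp_continuous_on[OF 0]]])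
    show "continuous_on S (\<lambda>p. Complex (fst p) (snd p))"
      unfolding Complex_eq by (intro continuous_intros)
  qed (auto simp: complex_region_def)
  then show ?case by (simp add: re_part_def case_prod_unfold)
next
  case (Suc k)
  note T = open_complex_region[OF S]
  have hol: "deriv g holomorphic_on complex_region S" "(\<lambda>z. \<i> * deriv g z) holomorphic_on complex_region S"
    using holomorphic_deriv[OF Suc.prems T] by (auto intro!: holomorphic_intros)
  show ?case
  proof (rule C_k_on_SucI[OF S Suc.IH[OF hol(1)] Suc.IH[OF hol(2)]])
    fix p assume "p \<in> S"
    then have "(g has_field_derivative deriv g (Complex (fst p) (snd p))) (at (Complex (fst p) (snd p)))"
      by (intro holomorphic_derivI[OF Suc.prems T]) (simp add: complex_region_def)
    from has_derivative_re_part[OF this]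
    show "(re_part g has_derivative
        (\<lambda>(h, j). h * re_part (deriv g) p + j * re_part (\<lambda>z. \<i> * deriv g z) p)) (at p)"
      by (simp add: re_part_def case_prod_unfold)
  qed
qed

lemma dx_dy_re_part:
  assumes "open S" "g holomorphic_on complex_region S" "p \<in> S"
  shows "dx (re_part g) p = re_part (deriv g) p" "dy (re_part g) p = re_part (\<lambda>z. \<i> * deriv g z) p"
proof -
  have "(g has_field_derivative deriv g (Complex (fst p) (snd p))) (at (Complex (fst p) (snd p)))"
    using assms(3) by (intro holomorphic_derivI[OF assms(2) open_complex_region[OF assms(1)]])
      (simp add: complex_region_def)
  from has_derivative_re_part[OF this] have
    "(re_part g has_derivative (\<lambda>(h, j). h * Re (deriv g (Complex (fst p) (snd p)))
       + j * Re (\<i> * deriv g (Complex (fst p) (snd p))))) (at p)" by simp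
  from dx_dy_eqI[OF this]
  show "dx (re_part g) p = re_part (deriv g) p" "dy (re_part g) p = re_part (\<lambda>z. \<i> * deriv g z) p"
    by (simp_all add: re_part_def case_prod_unfold)
qed

text \<open>Each \<open>dx\<close> differentiates \<open>g\<close>, each \<open>dy\<close> also
  multiplies by \<open>i\<close>; the two second derivatives are thus the real parts of
  \<open>g''\<close> and \<open>i^2 g'' = - g''\<close>.\<close>

lemma laplacian_re_part:
  assumes S: "open S" and g: "g holomorphic_on complex_region S" and p: "p \<in> S"
  shows "laplacian (re_part g) p = 0"
proof -
  note T = open_complex_region[OF S]
  have hol: "deriv g holomorphic_on complex_region S" "(\<lambda>z. \<i> * deriv g z) holomorphic_on complex_region S"
    using holomorphic_deriv[OF g T] by (auto intro!: holomorphic_intros)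
  have "dx (dx (re_part g)) p = dx (re_part (deriv g)) p"
    by (rule dx_dy_cong(1)[OF S p]) (rule dx_dy_re_part(1)[OF S g])
  also have "\<dots> = re_part (deriv (deriv g)) p"
    by (rule dx_dy_re_part(1)[OF S hol(1) p])
  finally have x: "dx (dx (re_part g)) p = re_part (deriv (deriv g)) p" .
  have "dy (dy (re_part g)) p = dy (re_part (\<lambda>z. \<i> * deriv g z)) p"
    by (rule dx_dy_cong(2)[OF S p]) (rule dx_dy_re_part(2)[OF S g])
  also have "\<dots> = re_part (\<lambda>z. \<i> * deriv (\<lambda>z. \<i> * deriv g z) z) p"
    by (rule dx_dy_re_part(2)[OF S hol(2) p])
  also have "\<dots> = - re_part (deriv (deriv g)) p"
  proof -
    have "deriv (\<lambda>z. \<i> * deriv g z) z = \<i> * deriv (deriv g) z" if "z \<in> complex_region S" for z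
      using holomorphic_on_imp_differentiable_at[OF hol(1) T that] by (rule deriv_cmult)
    moreover have "Complex (fst p) (snd p) \<in> complex_region S"
      using p by (simp add: complex_region_def)
    ultimately show ?thesis by (simp add: re_part_def case_prod_unfold)
  qed
  finally show ?thesis using x by (simp add: laplacian_def)
qed

text \<open>The Cauchy-Riemann equations for \<open>u_x - i u_y\<close> are the Laplace equation and
  the symmetry of the mixed partials.\<close>

lemma harmonic_gradient_holomorphic:
  assumes S: "open S" and u: "C_k_on 2 u S" and lap: "\<And>p. p \<in> S \<Longrightarrow> laplacian u p = 0"
  shows "(\<lambda>z. Complex (dx u (Re z, Im z)) (- dy u (Re z, Im z))) holomorphic_on complex_region S"
proof -
  have u2: "C_k_on (Suc (Suc 0)) u S" using u by (simp only: numeral_2_eq_2)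
  have "(\<lambda>z. Complex (dx u (Re z, Im z)) (- dy u (Re z, Im z))) field_differentiable at z"
    if "z \<in> complex_region S" for z
  proof -
    define p where "p = (Re z, Im z)"
    have p: "p \<in> S" using that by (simp add: p_def complex_region_def)
    have id: "((\<lambda>z. (Re z, Im z)) has_derivative (\<lambda>k. (Re k, Im k))) (at z)"
      by (auto intro!: derivative_eq_intros)
    have x: "((\<lambda>z. dx u (Re z, Im z)) has_derivative
        (\<lambda>k. Re k * dx (dx u) p + Im k * dy (dx u) p)) (at z)"
      using has_derivative_compose[OF id
          C_k_on_has_derivative[OF S C_k_on_dx[OF S u2] p, unfolded p_def]]
      by (simp add: p_def)
    have y: "((\<lambda>z. dy u (Re z, Im z)) has_derivative
        (\<lambda>k. Re k * dx (dy u) p + Im k * dy (dy u) p)) (at z)"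
      using has_derivative_compose[OF id
          C_k_on_has_derivative[OF S C_k_on_dy[OF S u2] p, unfolded p_def]]
      by (simp add: p_def)
    have eqs: "dy (dy u) p = - dx (dx u) p" "dy (dx u) p = dx (dy u) p"
      using lap[OF p] mixed_partials_commute[OF S u2 p] by (simp_all add: laplacian_def)
    have "((\<lambda>z. complex_of_real (dx u (Re z, Im z)) + \<i> * complex_of_real (- dy u (Re z, Im z)))
        has_derivative (\<lambda>k. complex_of_real (Re k * dx (dx u) p + Im k * dy (dx u) p) +
          \<i> * complex_of_real (- (Re k * dx (dy u) p + Im k * dy (dy u) p)))) (at z)"
      by (intro has_derivative_add has_derivative_mult_right has_derivative_of_real
          has_derivative_minus x y)
    \<comment> \<open>By \<open>eqs\<close> the real-linear derivative is multiplication by one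
      complex number, which is complex differentiability.\<close>
    also have "(\<lambda>k. complex_of_real (Re k * dx (dx u) p + Im k * dy (dx u) p) +
          \<i> * complex_of_real (- (Re k * dx (dy u) p + Im k * dy (dy u) p))) =
        (*) (Complex (dx (dx u) p) (- dx (dy u) p))"
      by (auto simp: fun_eq_iff complex_eq_iff eqs algebra_simps)
    finally show ?thesis
      unfolding Complex_eq field_differentiable_def has_field_derivative_def by blast
  qed
  then show ?thesis
    by (meson field_differentiable_at_within holomorphic_on_def)
qed

text \<open>With \<open>g = u_x - i u_y\<close>, the partials of \<open>u\<close> are the real parts
  of \<open>g\<close> and \<open>i g\<close>, which are of class \<open>C_k_on\<close> for every
  order because \<open>g\<close> is holomorphic.\<close>

lemma harmonic_C_k:
  assumes S: "open S" and u: "C_k_on 2 u S" and lap: "\<And>p. p \<in> S \<Longrightarrow> laplacian u p = 0"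
  shows "C_k_on k u S"
proof (cases k)
  case 0
  then show ?thesis using C_k_on_mono[OF u, of 0] by simp
next
  case (Suc m)
  have u1: "C_k_on (Suc 1) u S" using u by (simp only: numeral_2_eq_2 One_nat_def)
  define g where "g = (\<lambda>z. Complex (dx u (Re z, Im z)) (- dy u (Re z, Im z)))"
  have g: "g holomorphic_on complex_region S" "(\<lambda>z. \<i> * g z) holomorphic_on complex_region S"
    using harmonic_gradient_holomorphic[OF assms] by (auto simp: g_def intro!: holomorphic_intros)
  show ?thesis unfolding Suc
  proof (rule C_k_on_SucI[OF S C_k_on_re_part[OF S g(1)] C_k_on_re_part[OF S g(2)]])
    fix p assume "p \<in> S"
    from C_k_on_has_derivative[OF S u1 this]
    show "(u has_derivative (\<lambda>(h, j). h * re_part g p + j * re_part (\<lambda>z. \<i> * g z) p)) (at p)"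
      by (simp add: re_part_def g_def case_prod_unfold)
  qed
qed

section \<open>The kernel is the space of harmonic functions\<close>

lemma laplacian_zero: "laplacian (\<lambda>_. 0) p = 0"
  by (simp add: laplacian_def dx_def dy_def case_prod_unfold)

lemma C_k_on_zero: "C_k_on k (\<lambda>_. 0) S"
  using C_k_on_re_part[of UNIV "\<lambda>_. 0" k] C_k_on_subset[of k _ UNIV S]
  by (auto simp: re_part_def case_prod_unfold)

lemma interior_square: "interior square = {-1<..<1} \<times> {-1<..<1}"
  by (simp add: square_def interior_Times)

lemma compact_square: "compact square"
  by (simp add: square_def compact_Times)

lemma bilaplace_kernel_eq_harmonic: "bilaplace_kernel = harmonic_functions"
proof (intro equalityI subsetI)
  fix u assume "u \<in> bilaplace_kernel"
  then obtain w where u: "u \<in> square_functions" "C_k_on 4 u (interior square)"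
      "\<And>p. p \<in> interior square \<Longrightarrow> bilaplacian u p = 0"
    and w: "C_k_on 1 w square" "\<And>p. p \<in> interior square \<Longrightarrow> w p = laplacian u p"
      "\<And>p. p \<in> frontier square \<Longrightarrow> w p = 0"
    unfolding bilaplace_kernel_def by blast
  have "(4::nat) = Suc (Suc 2)" by simp
  then have u4: "C_k_on (Suc (Suc 2)) u (interior square)"
    using u(2) by (simp only:)
  have lapu: "C_k_on 2 (laplacian u) (interior square)"
    unfolding laplacian_def
    by (intro C_k_on_add C_k_on_dx[OF open_interior] C_k_on_dy[OF open_interior] u4)
  \<comment> \<open>The extension \<open>w\<close> inherits second-order regularity in the interior
    from \<open>laplacian u\<close>; on the closed square only its continuity enters the maximum
    principle.\<close>
  have w2: "C_k_on 2 w (interior square)"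
    by (rule iffD2[OF C_k_on_cong[OF w(2)] lapu])
  have lapw: "laplacian w p = 0" if "p \<in> interior square" for p
    using laplacian_cong[OF open_interior that w(2)] u(3)[OF that]
      bilaplacian_eq_laplacian_laplacian[OF open_interior u(2) that] by simp
  have w0: "continuous_on square w"
    using C_k_on_mono[OF w(1), of 0] by simp
  have "laplacian u p = 0" if "p \<in> interior square" for p
    using maximum_principle[OF compact_square w0 w2 lapw w(3)] w(2)[OF that] that interior_subset
    by (metis subsetD)
  moreover have "C_k_on 2 u (interior square)" using C_k_on_mono[OF u(2)] by simp
  ultimately show "u \<in> harmonic_functions" using u(1) by (simp add: harmonic_functions_def)
next
  fix u assume "u \<in> harmonic_functions"
  then have u: "u \<in> square_functions" "C_k_on 2 u (interior square)"
      "\<And>p. p \<in> interior square \<Longrightarrow> laplacian u p = 0"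
    by (simp_all add: harmonic_functions_def)
  have u4: "C_k_on 4 u (interior square)"
    using harmonic_C_k[OF open_interior u(2,3)] .
  have "bilaplacian u p = 0" if "p \<in> interior square" for p
    using bilaplacian_eq_laplacian_laplacian[OF open_interior u4 that]
      laplacian_cong[OF open_interior that, of "laplacian u" "\<lambda>_. 0"] u(3) laplacian_zero by simp
  moreover have "has_normal_derivative (\<lambda>_. 0) 0 p \<nu>" for p \<nu>
    by (simp add: has_normal_derivative_def)
  \<comment> \<open>For harmonic \<open>u\<close> the extension of the Laplacian is the zero
    function, which satisfies both boundary conditions.\<close>
  ultimately show "u \<in> bilaplace_kernel"
    unfolding bilaplace_kernel_def using u(1,3) u4 C_k_on_zero[of 1 square]
    by (intro CollectI conjI exI[of _ "\<lambda>_. 0"]) auto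
qed

lemma subspace_harmonic_functions: "fun_space.subspace harmonic_functions"
proof (rule fun_space.subspaceI)
  show "0 \<in> harmonic_functions"
    using C_k_on_zero laplacian_zero
    by (auto simp: harmonic_functions_def square_functions_def zero_fun_def)
  show "u + v \<in> harmonic_functions" if "u \<in> harmonic_functions" "v \<in> harmonic_functions" for u v
    using that C_k_on_add[of 2 u "interior square" v] laplacian_add[OF open_interior, of u square v]
    by (auto simp: harmonic_functions_def square_functions_def plus_fun_def)
  show "fun_scale c u \<in> harmonic_functions" if "u \<in> harmonic_functions" for c u
    using that C_k_on_scale[of 2 u "interior square" c] laplacian_scale[OF open_interior, of u square _ c]
    by (auto simp: harmonic_functions_def square_functions_def fun_scale_def)
qed

subsection \<open>An orthogonal system\<close>

text \<open>The product formula turns the integrand into a sum of cosines with explicit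
  antiderivatives, whose sine terms vanish at both endpoints. Positive indices exclude the constant
  mode, whose square integrates to 2.\<close>

lemma set_integral_cos_cos:
  fixes m n :: nat
  assumes "m > 0" "n > 0"
  shows "(LINT x:{-1<..<1}|lborel. cos (m * pi * x) * cos (n * pi * x)) = (if m = n then 1 else 0)"
proof -
  have F: "(LINT x:{-1<..<1}|lborel. cos (m * pi * x) * cos (n * pi * x)) = F 1 - F (-1)"
    if "\<And>x. (F has_real_derivative cos (m * pi * x) * cos (n * pi * x)) (at x)" for F :: "real \<Rightarrow> real"
  proof -
    \<comment> \<open>The interval integral unfolds to the set integral over the open interval, so
      the fundamental theorem of calculus applies.\<close>
    have "(LBINT x=ereal (-1)..ereal 1. cos (m * pi * x) * cos (n * pi * x)) = F 1 - F (-1)"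
      by (rule interval_integral_FTC_finite)
        (auto intro!: continuous_intros has_field_derivative_at_within[OF that]
          simp flip: has_real_derivative_iff_has_vector_derivative)
    then show ?thesis by (simp add: interval_lebesgue_integral_def)
  qed
  show ?thesis
  proof (cases "m = n")
    case True
    have "((\<lambda>x. x / 2 + sin (2 * n * pi * x) / (4 * n * pi))
        has_real_derivative cos (m * pi * x) * cos (n * pi * x)) (at x)" for x
    proof -
      have *: "cos (m * pi * x) * cos (n * pi * x) = 1 / 2 + cos (2 * n * pi * x) / 2"
        by (simp add: cos_times_cos True add_divide_distrib algebra_simps)
      show ?thesis
        unfolding * using assms by (auto intro!: derivative_eq_intros)
    qed
    from F[OF this] show ?thesis
      using sin_npi[of "2 * n"] by (simp add: True)
  next
    case False
    \<comment> \<open>The difference is taken in the reals, so it may be negative; both numbers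
      occur as denominators in the antiderivative.\<close>
    have nz: "real m - n \<noteq> 0" "real m + n \<noteq> 0" using False assms by auto
    have D: "((\<lambda>x. sin ((real m - n) * pi * x) / (2 * (real m - n) * pi) +
         sin ((real m + n) * pi * x) / (2 * (real m + n) * pi))
        has_real_derivative cos (m * pi * x) * cos (n * pi * x)) (at x)" for x
    proof -
      have *: "cos (m * pi * x) * cos (n * pi * x) =
          (cos ((real m - n) * pi * x) + cos ((real m + n) * pi * x)) / 2"
        by (simp add: cos_times_cos algebra_simps)
      have d: "((\<lambda>x. sin (k * pi * x) / (2 * k * pi)) has_real_derivative cos (k * pi * x) / 2) (at x)"
        if "k \<noteq> 0" for k
        using that by (auto intro!: derivative_eq_intros)
      show ?thesis
        unfolding * add_divide_distrib by (intro DERIV_add d nz)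
    qed
    have "sin ((real m - n) * pi) = 0"
      by (simp add: sin_times_pi_eq_0)
    moreover have "sin ((real m + n) * pi) = 0"
      by (simp add: sin_times_pi_eq_0)
    ultimately show ?thesis using F[OF D] False by simp
  qed
qed

text \<open>In the interior this is the real part of \<open>exp (i n pi z)\<close> with
  \<open>z = x + i y\<close>; the value 0 elsewhere places it in
  \<open>square_functions\<close>.\<close>

definition mode :: "nat \<Rightarrow> real \<times> real \<Rightarrow> real" where
  "mode n = (\<lambda>p. if p \<in> interior square then cos (n * pi * fst p) * exp (- (n * pi * snd p)) else 0)"

lemma mode_harmonic: "mode n \<in> harmonic_functions"
proof -
  let ?g = "\<lambda>z. exp (\<i> * of_real (n * pi) * z)"
  have g: "?g holomorphic_on complex_region (interior square)"
    by (intro holomorphic_intros)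
  have eq: "mode n p = re_part ?g p" if "p \<in> interior square" for p
    using that by (simp add: mode_def re_part_def case_prod_unfold Re_exp mult.commute)
  have "C_k_on 2 (mode n) (interior square)"
    by (rule iffD2[OF C_k_on_cong[OF eq] C_k_on_re_part[OF open_interior g]])
  moreover have "laplacian (mode n) p = 0" if "p \<in> interior square" for p
    using laplacian_cong[OF open_interior that eq] laplacian_re_part[OF open_interior g that] by simp
  ultimately show ?thesis
    by (auto simp: harmonic_functions_def square_functions_def mode_def)
qed

text \<open>The cut-off makes the modes discontinuous at the boundary, so integrability comes from
  the uncut product \<open>W\<close>, continuous on the compact square and then restricted to the
  interior.\<close>

lemma integrable_mode_mult: "set_integrable lborel square (\<lambda>p. mode m p * mode n p)"
proof -
  define W :: "real \<times> real \<Rightarrow> real" where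
    "W = (\<lambda>p. (cos (m * pi * fst p) * exp (- (m * pi * snd p))) *
      (cos (n * pi * fst p) * exp (- (n * pi * snd p))))"
  have "set_integrable lborel square W"
    unfolding set_integrable_def W_def
    by (intro borel_integrable_compact compact_square continuous_intros)
  then have "set_integrable lborel (interior square) W"
    by (rule set_integrable_subset) (auto simp: interior_subset)
  moreover have "indicat_real square p *\<^sub>R (mode m p * mode n p) =
      indicat_real (interior square) p *\<^sub>R W p" for p
    using interior_subset[of square] by (auto simp: mode_def W_def indicator_def)
  ultimately show ?thesis by (simp only: set_integrable_def)
qed

lemma mode_L2: "mode n \<in> L2_square"
proof -
  have "continuous_on (interior square) (mode n)"
    using mode_harmonic[of n] C_k_on_mono[of 2 "mode n" "interior square" 0]
    by (simp add: harmonic_functions_def)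
  then have "(\<lambda>p. indicat_real (interior square) p *\<^sub>R mode n p) \<in> borel_measurable borel"
    by (intro borel_measurable_continuous_on_indicator) auto
  also have "(\<lambda>p. indicat_real (interior square) p *\<^sub>R mode n p) = (\<lambda>p. indicat_real square p *\<^sub>R mode n p)"
    using interior_subset[of square] by (auto simp: mode_def indicator_def fun_eq_iff)
  finally show ?thesis
    using integrable_mode_mult[of n n]
    by (simp add: L2_square_def set_borel_measurable_def power2_eq_square)
qed

text \<open>The integrand separates into a function of \<open>x\<close> and a function
  \<open>E\<close> of \<open>y\<close>. Integrating over \<open>x\<close> first leaves the cosine
  integral, which is 0 for distinct indices.\<close>

lemma mode_orthogonal:
  assumes "m > 0" "n > 0" "m \<noteq> n"
  shows "L2_orthogonal (mode m) (mode n)"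
proof -
  define f where "f = (\<lambda>x y. indicat_real square (x, y) *\<^sub>R (mode m (x, y) * mode n (x, y)))"
  define E where "E = (\<lambda>y. indicat_real {-1<..<1} y * (exp (- (m * pi * y)) * exp (- (n * pi * y))))"
  have f: "f x y = (indicat_real {-1<..<1} x *\<^sub>R (cos (m * pi * x) * cos (n * pi * x))) * E y" for x y
  proof -
    have "x \<in> {-1<..<1} \<Longrightarrow> y \<in> {-1<..<1} \<Longrightarrow> (x, y) \<in> square" by (simp add: square_def)
    then show ?thesis
      by (auto simp: f_def E_def mode_def interior_square indicator_def)
  qed
  have int: "integrable (lborel \<Otimes>\<^sub>M lborel) (case_prod f)"
    using integrable_mode_mult[of m n]
    by (simp add: set_integrable_def f_def lborel_prod case_prod_unfold)
  have "(LINT p:square|lborel. mode m p * mode n p) = integral\<^sup>L (lborel \<Otimes>\<^sub>M lborel) (case_prod f)"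
    by (simp add: set_lebesgue_integral_def f_def lborel_prod case_prod_unfold)
  also have "\<dots> = (LINT y|lborel. LINT x|lborel. f x y)"
    using lborel_pair.integral_snd[OF int] by simp
  also have "\<dots> = 0"
    using set_integral_cos_cos[OF assms(1,2)] assms(3)
    by (simp add: f set_lebesgue_integral_def)
  finally show ?thesis by (simp add: L2_orthogonal_def)
qed

section \<open>Linear independence of the modes and infinite dimension\<close>

lemma mode_axis: "x \<in> {-1<..<1} \<Longrightarrow> mode n (x, 0) = cos (n * pi * x)"
  by (simp add: mode_def interior_square)

text \<open>Equal modes have equal cosines on the axis; integrating against
  \<open>cos (m * pi * x)\<close> would then give \<open>1 = 0\<close>.\<close>

lemma inj_on_mode: "inj_on mode {0<..}"
proof (rule inj_onI, rule ccontr)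
  fix m n :: nat assume mn: "m \<in> {0<..}" "n \<in> {0<..}" "mode m = mode n" "m \<noteq> n"
  have "(LINT x:{-1<..<1}|lborel. cos (m * pi * x) * cos (m * pi * x)) =
      (LINT x:{-1<..<1}|lborel. cos (m * pi * x) * cos (n * pi * x))"
    by (rule set_lebesgue_integral_cong) (use mn mode_axis in \<open>auto, metis\<close>)
  then show False using mn by (simp add: set_integral_cos_cos)
qed

lemma sum_fun_apply: "(\<Sum>i\<in>I. F i) x = (\<Sum>i\<in>I. F i x)"
  for F :: "'i \<Rightarrow> 'a \<Rightarrow> 'b::comm_monoid_add"
  by (induction I rule: infinite_finite_induct) auto

text \<open>On the axis a vanishing combination of modes is a vanishing cosine sum, and integrating
  it against the cosine of index \<open>j\<close> isolates the coefficient of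
  \<open>mode j\<close>.\<close>

lemma independent_modes:
  assumes I: "finite I" "I \<subseteq> {0<..}"
  shows "fun_space.independent (mode ` I)"
proof (rule fun_space.independent_if_scalars_zero)
  show "finite (mode ` I)" using I by simp
  fix c :: "(real \<times> real \<Rightarrow> real) \<Rightarrow> real" and f
  assume zero: "(\<Sum>g\<in>mode ` I. fun_scale (c g) g) = 0" and "f \<in> mode ` I"
  then obtain j where j: "j \<in> I" "f = mode j" by auto
  \<comment> \<open>The coefficients are indexed by functions; injectivity turns the sum over
    \<open>mode\<close> into one over indices.\<close>
  have inj: "inj_on mode I" using inj_on_mode I(2) by (rule inj_on_subset)
  have *: "(\<Sum>i\<in>I. c (mode i) * cos (i * pi * x)) = 0" if "x \<in> {-1<..<1}" for x
  proof -
    have "(\<Sum>g\<in>mode ` I. fun_scale (c g) g) (x, 0) = 0" by (simp add: zero)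
    then show ?thesis
      by (simp add: sum_fun_apply fun_scale_def sum.reindex[OF inj] mode_axis[OF that])
  qed
  have int: "set_integrable lborel {-1<..<1} (\<lambda>x. cos (i * pi * x) * cos (j * pi * x))" for i
    by (rule set_integrable_subset[OF borel_integrable_atLeastAtMost'[of "-1" 1]])
      (auto intro!: continuous_intros)
  have "0 = (LINT x:{-1<..<1}|lborel. (\<Sum>i\<in>I. c (mode i) * cos (i * pi * x)) * cos (j * pi * x))"
    using * by (subst set_lebesgue_integral_cong[where g = "\<lambda>_. 0"]) auto
  also have "\<dots> = (LINT x:{-1<..<1}|lborel. (\<Sum>i\<in>I. c (mode i) * (cos (i * pi * x) * cos (j * pi * x))))"
    by (simp add: sum_distrib_right mult.assoc)
  also have "\<dots> = (\<Sum>i\<in>I. LINT x:{-1<..<1}|lborel. c (mode i) * (cos (i * pi * x) * cos (j * pi * x)))"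
    using int unfolding set_lebesgue_integral_def set_integrable_def scaleR_sum_right
    by (intro Bochner_Integration.integral_sum) (simp add: mult.left_commute)
  also have "\<dots> = (\<Sum>i\<in>I. if i = j then c (mode i) else 0)"
    using I j set_integral_cos_cos by (intro sum.cong refl) (auto simp: subset_iff)
  also have "\<dots> = c f" using j I by simp
  finally show "c f = 0" by simp
qed

lemma infinite_dimensional_harmonic_functions: "infinite_dimensional harmonic_functions"
  unfolding infinite_dimensional_def
proof (intro conjI subspace_harmonic_functions notI)
  assume "\<exists>B. finite B \<and> harmonic_functions \<subseteq> fun_space.span B"
  then obtain B where B: "finite B" "harmonic_functions \<subseteq> fun_space.span B" by blast
  \<comment> \<open>One index more than \<open>B\<close> has elements: that many independent modes
    cannot lie in the span of \<open>B\<close>.\<close>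
  define I where "I = {1..card B + 1}"
  have I: "finite I" "I \<subseteq> {0<..}" by (auto simp: I_def)
  have "mode ` I \<subseteq> fun_space.span B" using mode_harmonic B(2) by blast
  then have "card (mode ` I) \<le> card B"
    using fun_space.independent_span_bound[OF B(1) independent_modes[OF I]] by simp
  moreover have "card (mode ` I) = card B + 1"
    using card_image[OF inj_on_subset[OF inj_on_mode I(2)]] by (simp add: I_def)
  ultimately show False by simp
qed

theorem theorem4p2:
  shows "bilaplace_kernel = harmonic_functions \<and>
    (\<exists>S. S \<subseteq> bilaplace_kernel \<and> countable S \<and> infinite S \<and> 0 \<notin> S \<and>
       S \<subseteq> L2_square \<and> pairwise L2_orthogonal S) \<and>
    infinite_dimensional bilaplace_kernel"
proof -
  let ?S = "mode ` {0<..}"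
  have "infinite ?S"
    using finite_imageD[OF _ inj_on_mode] infinite_Ioi by blast
  \<comment> \<open>At the origin every mode has the value \<open>cos 0 = 1\<close>.\<close>
  moreover have "mode n \<noteq> 0" for n
    using mode_axis[of 0 n] by (auto simp: fun_eq_iff intro!: exI[of _ 0])
  then have "0 \<notin> ?S" by (metis imageE)
  moreover have "pairwise L2_orthogonal ?S"
    by (rule pairwise_imageI) (simp add: mode_orthogonal)
  moreover have "?S \<subseteq> harmonic_functions" "?S \<subseteq> L2_square"
    using mode_harmonic mode_L2 by blast+
  moreover have "countable ?S" by simp
  ultimately show ?thesis
    unfolding bilaplace_kernel_eq_harmonic
    using infinite_dimensional_harmonic_functions by blast
qed

end
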